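(* Let $M$ be a harmonic matroid and let $x,x',y,z$ be points of $M$. Then (i) $\mathrm{H}(y,z;x,x')$ if and only if $\mathrm{H}(y,z;x',x)$; (ii) if $x\neq x'$ and $y\neq z$, then $\mathrm{H}(y,z;x,x')$ if and only if $\mathrm{H}(x,x';y,z)$.
   Context: Matroids may have an infinite ground set; $\operatorname{cl}$ denotes closure. Matroids are taken to be simple, so that "point" means element (for lattice-type examples, a rank-one flat); a set of points is collinear if it has rank at most $2$. For elements $y,x,z,o,q,r,s$ of a matroid $M$, $\mathrm{HP}(y,x,z;o,q,r,s)$ means that these are seven distinct elements and the restriction $M|\{y,x,z,o,q,r,s\}$ is a rank-3 matroid whose three-point lines are $\{y,x,z\},\{y,o,q\},\{y,r,s\},\{x,q,s\},\{z,o,s\},\{z,q,r\}$ and possibly also $\{x,o,r\}$, and no other set of three elements is collinear (so it is the non-Fano matroid $F_7^-$, or the Fano matroid $F_7$ if $\{x,o,r\}$ is collinear). For elements $y,x,z$ of $M$, a point $x'$ is a harmonic conjugate of $x$ with respect to $y$ and $z$, written $\mathrm{H}(y,z;x,x')$, if there are elements $o,q,r,s$ with $\mathrm{HP}(y,x,z;o,q,r,s)$ and $\operatorname{cl}(\{y,z\})\cap\operatorname{cl}(\{o,r\})=\{x'\}$. A harmonic matroid is a matroid such that every $\{y,x,z,o,q,r,s\}$ with $\mathrm{HP}(y,x,z;o,q,r,s)$ gives rise to such a harmonic conjugate $x'$, and $x'$ depends only on $x,y,z$ and not on the choice of $o,q,r,s$. *)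

theory Defs
  imports Main "HOL-Library.Extended_Nat"
begin

text \<open>
  Matroids on a possibly infinite ground set, given by their closure operator: an operator with
  the exchange property and of finite character. Finite matroids, matroids of finite rank and
  full algebraic matroids are all of this form. Values of \<open>cl\<close> on sets that are not contained in
  the ground set are irrelevant.
\<close>

record 'a matroid =
  ground :: "'a set"
  cl :: "'a set \<Rightarrow> 'a set"

definition is_matroid :: "'a matroid \<Rightarrow> bool" where
  "is_matroid M \<longleftrightarrow>
     (\<forall>A. A \<subseteq> ground M \<longrightarrow> A \<subseteq> cl M A \<and> cl M A \<subseteq> ground M) \<and>
     (\<forall>A B. A \<subseteq> B \<and> B \<subseteq> ground M \<longrightarrow> cl M A \<subseteq> cl M B) \<and>
     (\<forall>A. A \<subseteq> ground M \<longrightarrow> cl M (cl M A) = cl M A) \<and>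
     (\<forall>A a b. A \<subseteq> ground M \<and> a \<in> ground M \<and> b \<in> cl M (insert a A) - cl M A \<longrightarrow>
        a \<in> cl M (insert b A)) \<and>
     (\<forall>A a. A \<subseteq> ground M \<and> a \<in> cl M A \<longrightarrow> (\<exists>F. finite F \<and> F \<subseteq> A \<and> a \<in> cl M F))"

definition simple_matroid :: "'a matroid \<Rightarrow> bool" where
  "simple_matroid M \<longleftrightarrow>
     is_matroid M \<and> cl M {} = {} \<and> (\<forall>e \<in> ground M. cl M {e} = {e})"

definition indep :: "'a matroid \<Rightarrow> 'a set \<Rightarrow> bool" where
  "indep M I \<longleftrightarrow> I \<subseteq> ground M \<and> (\<forall>e \<in> I. e \<notin> cl M (I - {e}))"

text \<open>Finite independent sets suffice, since every subset of an independent set is independent.\<close>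

definition rank :: "'a matroid \<Rightarrow> 'a set \<Rightarrow> enat" where
  "rank M X = (SUP I \<in> {I. indep M I \<and> finite I \<and> I \<subseteq> X}. enat (card I))"

definition collinear :: "'a matroid \<Rightarrow> 'a set \<Rightarrow> bool" where
  "collinear M X \<longleftrightarrow> X \<subseteq> ground M \<and> rank M X \<le> 2"

definition restr :: "'a matroid \<Rightarrow> 'a set \<Rightarrow> 'a matroid" where
  "restr M X = \<lparr>ground = X, cl = (\<lambda>A. cl M A \<inter> X)\<rparr>"

definition is_line :: "'a matroid \<Rightarrow> 'a set \<Rightarrow> bool" where
  "is_line M L \<longleftrightarrow> L \<subseteq> ground M \<and> cl M L = L \<and> rank M L = 2"

definition three_point_lines :: "'a matroid \<Rightarrow> 'a set set" where
  "three_point_lines M = {L. is_line M L \<and> card L = 3}"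

text \<open>
  The arguments of \<open>HP M y x z p q r s\<close> are those of $\mathrm{HP}(y,x,z;o,q,r,s)$; the letter $o$ is
  replaced by \<open>p\<close> because \<open>o\<close> is input syntax for function composition.
\<close>

definition HP :: "'a matroid \<Rightarrow> 'a \<Rightarrow> 'a \<Rightarrow> 'a \<Rightarrow> 'a \<Rightarrow> 'a \<Rightarrow> 'a \<Rightarrow> 'a \<Rightarrow> bool" where
  "HP M y x z p q r s \<longleftrightarrow>
     (let S = {y, x, z, p, q, r, s};
          N = restr M S;
          \<L> = {{y, x, z}, {y, p, q}, {y, r, s}, {x, q, s}, {z, p, s}, {z, q, r}}
      in distinct [y, x, z, p, q, r, s] \<and> S \<subseteq> ground M \<and> rank N S = 3 \<and>
         (three_point_lines N = \<L> \<or> three_point_lines N = insert {x, p, r} \<L>) \<and>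
         (\<forall>T. T \<subseteq> S \<and> card T = 3 \<and> collinear N T \<longrightarrow> T \<in> three_point_lines N))"

text \<open>\<open>harmonic_conj M y z x x'\<close> is $\mathrm{H}(y,z;x,x')$.\<close>

definition harmonic_conj :: "'a matroid \<Rightarrow> 'a \<Rightarrow> 'a \<Rightarrow> 'a \<Rightarrow> 'a \<Rightarrow> bool" where
  "harmonic_conj M y z x x' \<longleftrightarrow>
     (\<exists>p q r s. HP M y x z p q r s \<and> cl M {y, z} \<inter> cl M {p, r} = {x'})"

definition harmonic_matroid :: "'a matroid \<Rightarrow> bool" where
  "harmonic_matroid M \<longleftrightarrow>
     simple_matroid M \<and>
     (\<forall>y x z p q r s. HP M y x z p q r s \<longrightarrow> (\<exists>x'. cl M {y, z} \<inter> cl M {p, r} = {x'})) \<and>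
     (\<forall>y x z x' x''. harmonic_conj M y z x x' \<and> harmonic_conj M y z x x'' \<longrightarrow> x' = x'')"

end

theory Submission
  imports Defs
begin

text \<open>
  A harmonic configuration is a complete quadrangle: the six lines of \<open>HP M y x z p q r s\<close> are the
  sides of the quadrangle with vertices \<open>y\<close>, \<open>z\<close>, \<open>q\<close>, \<open>s\<close>, and \<open>x\<close>, \<open>p\<close>, \<open>r\<close> are its diagonal
  points (\<open>HP_iff_quadrangle\<close>). The possible seventh line says that the diagonal points are collinear.
  In this form the configuration has the symmetry of the symmetric group on the vertices, so the
  existence of conjugates, demanded for one side, makes the line through any two diagonal points
  meet both sides through the third one (\<open>fourth_point\<close>). Lines of a matroid need not meet, even in
  a plane, so every point of intersection has to be obtained in this way, and every new collinearity
  comes from the uniqueness of the conjugate.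

  Let the quadrangle \<open>a b c d\<close> with diagonal points \<open>e = ab \<inter> cd\<close>, \<open>f = ac \<inter> bd\<close>, \<open>g = ad \<inter> bc\<close> give the
  conjugate \<open>e'\<close> of \<open>e\<close> on \<open>ab\<close>, cut out by \<open>fg\<close>. Then \<open>a b f g\<close> is a quadrangle with diagonal points
  \<open>e'\<close>, \<open>c\<close>, \<open>d\<close>, and the line \<open>cd\<close> cuts \<open>ab\<close> in \<open>e\<close>. This is the symmetry of the conjugate in the pair
  \<open>e\<close>, \<open>e'\<close>.

  To exchange the pairs \<open>a, b\<close> and \<open>e, e'\<close> one needs a quadrangle with sides through these points in
  the other order. View \<open>ab\<close> as the line at infinity. Then \<open>c\<close>, \<open>d\<close>, \<open>f\<close>, \<open>g\<close> are the vertices of a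
  parallelogram whose sides have the directions \<open>a\<close> and \<open>b\<close> and whose diagonals \<open>cd\<close>, \<open>fg\<close> have the
  directions \<open>e\<close> and \<open>e'\<close>. The diagonals meet in the centre \<open>P\<close>, and the parallel through \<open>P\<close> to the
  direction \<open>a\<close> meets the side \<open>cg\<close> in its midpoint \<open>v\<close>. Reflecting \<open>P\<close> in \<open>v\<close>, that is, taking
  its conjugate with respect to \<open>v\<close> and \<open>a\<close>, yields a point \<open>k\<close> such that \<open>P c k g\<close> is a
  parallelogram with sides of directions \<open>e\<close> and \<open>e'\<close> and diagonals of directions \<open>a\<close> and \<open>b\<close>, which
  is the quadrangle wanted. That \<open>k\<close> lies on \<open>eg\<close> is \<open>reflected_diagonal_point\<close>. That it lies on
  \<open>e'c\<close> is the same lemma for the quadrangle \<open>a b g f\<close>: it has the same \<open>P\<close> and \<open>v\<close>, hence, by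
  uniqueness of the conjugate, the same \<open>k\<close>.
\<close>

section \<open>Rank and collinearity in a simple matroid\<close>

locale simple_points =
  fixes M :: "'a matroid"
  assumes simple: "simple_matroid M"
begin

abbreviation col :: "'a \<Rightarrow> 'a \<Rightarrow> 'a \<Rightarrow> bool" where
  "col a b c \<equiv> collinear M {a, b, c}"

lemma two_eq_card_pair: "a \<noteq> b \<Longrightarrow> (2::enat) = enat (card {a, b})"
  by (simp add: numeral_eq_enat eval_nat_numeral)

lemma is_matroid: "is_matroid M" and cl_empty: "cl M {} = {}"
  and cl_singleton: "e \<in> ground M \<Longrightarrow> cl M {e} = {e}"
  using simple unfolding simple_matroid_def by blast+

lemma cl_ext: "A \<subseteq> ground M \<Longrightarrow> A \<subseteq> cl M A"
  using is_matroid unfolding is_matroid_def by metis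

lemma cl_ground: "A \<subseteq> ground M \<Longrightarrow> cl M A \<subseteq> ground M"
  using is_matroid unfolding is_matroid_def by metis

lemma cl_mono: "A \<subseteq> B \<Longrightarrow> B \<subseteq> ground M \<Longrightarrow> cl M A \<subseteq> cl M B"
  using is_matroid unfolding is_matroid_def by metis

lemma cl_idem: "A \<subseteq> ground M \<Longrightarrow> cl M (cl M A) = cl M A"
  using is_matroid unfolding is_matroid_def by metis

lemma exchange:
  "A \<subseteq> ground M \<Longrightarrow> a \<in> ground M \<Longrightarrow> b \<in> cl M (insert a A) \<Longrightarrow> b \<notin> cl M A
    \<Longrightarrow> a \<in> cl M (insert b A)"
  using is_matroid unfolding is_matroid_def by (metis DiffI)

lemma cl_subset: "A \<subseteq> cl M B \<Longrightarrow> B \<subseteq> ground M \<Longrightarrow> cl M A \<subseteq> cl M B"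
  using cl_mono cl_idem cl_ground by metis

lemma indep_insert:
  assumes "indep M I" "f \<in> ground M" "f \<notin> cl M I"
  shows "indep M (insert f I)"
  unfolding indep_def
proof (intro conjI ballI)
  have I: "I \<subseteq> ground M" using assms(1) by (simp add: indep_def)
  then show "insert f I \<subseteq> ground M" using assms(2) by simp
  fix e assume e: "e \<in> insert f I"
  show "e \<notin> cl M (insert f I - {e})"
  proof (cases "e = f")
    case True
    then show ?thesis using assms(3) cl_mono[of "I - {f}" I] I by auto
  next
    case False
    then have eI: "e \<in> I" using e by simp
    then have ne: "e \<notin> cl M (I - {e})" using assms(1) by (simp add: indep_def)
    have eq: "insert f I - {e} = insert f (I - {e})" using False by auto
    show ?thesis
    proof
      assume "e \<in> cl M (insert f I - {e})"
      then have "f \<in> cl M (insert e (I - {e}))"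
        using exchange[of "I - {e}" f e] ne I assms(2) eq by auto
      then show False using assms(3) eI by (simp add: insert_absorb)
    qed
  qed
qed

lemma indep_subset: "indep M I \<Longrightarrow> J \<subseteq> I \<Longrightarrow> indep M J"
  unfolding indep_def
proof (elim conjE, intro conjI ballI)
  fix e assume "J \<subseteq> I" "I \<subseteq> ground M" "\<forall>e\<in>I. e \<notin> cl M (I - {e})" "e \<in> J"
  then show "e \<notin> cl M (J - {e})" using cl_mono[of "J - {e}" "I - {e}"] by blast
qed auto

text \<open>
  Steinitz exchange: an element of \<open>I\<close> outside \<open>F\<close> can be traded for one of \<open>F\<close>, since otherwise
  \<open>F\<close>, and with it \<open>I\<close>, would lie in the closure of \<open>I\<close> without that element.
\<close>

lemma indep_card_le:
  assumes "indep M I" "finite I" "finite F" "F \<subseteq> ground M" "I \<subseteq> cl M F"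
  shows "card I \<le> card F"
  using assms
proof (induction "card (I - F)" arbitrary: I rule: less_induct)
  case less
  note I = less.prems
  show ?case
  proof (cases "I \<subseteq> F")
    case True
    then show ?thesis using I(3) card_mono by blast
  next
    case False
    then obtain e where e: "e \<in> I" "e \<notin> F" by blast
    have Ig: "I \<subseteq> ground M" using I(1) by (simp add: indep_def)
    have ne: "e \<notin> cl M (I - {e})" using I(1) e by (simp add: indep_def)
    then have "\<not> F \<subseteq> cl M (I - {e})"
      using cl_subset[of F "I - {e}"] e(1) I(5) Ig by blast
    then obtain f where f: "f \<in> F" "f \<notin> cl M (I - {e})" by blast
    then have fI: "f \<notin> I - {e}" using cl_ext[of "I - {e}"] Ig by blast
    let ?J = "insert f (I - {e})"
    have J: "indep M ?J"
      using indep_insert[of "I - {e}" f] indep_subset[OF I(1)] f I(4) by blast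
    have "card (?J - F) < card (I - F)"
      using e f I(2) by (intro psubset_card_mono) auto
    moreover have "?J \<subseteq> cl M F" using I(5) f cl_ext[OF I(4)] by blast
    ultimately have "card ?J \<le> card F"
      using less.hyps[OF _ J] I by simp
    moreover have "card ?J = card I" using fI e(1) I(2)
      by (metis card.remove card_insert_disjoint finite_Diff)
    ultimately show ?thesis by simp
  qed
qed

lemma rank_le:
  assumes "finite F" "F \<subseteq> ground M" "X \<subseteq> cl M F"
  shows "rank M X \<le> card F"
  unfolding rank_def using indep_card_le[OF _ _ assms(1,2)] assms(3)
  by (intro SUP_least) auto

lemma card_le_rank: "indep M I \<Longrightarrow> finite I \<Longrightarrow> I \<subseteq> X \<Longrightarrow> card I \<le> rank M X"
  unfolding rank_def by (intro SUP_upper) simp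

lemma indep_pair: 
  assumes "a \<in> ground M" "b \<in> ground M" "a \<noteq> b"
  shows "indep M {a, b}"
proof -
  have "indep M {b}" using assms by (simp add: indep_def cl_empty)
  then show ?thesis using assms indep_insert[of "{b}" a] by (simp add: cl_singleton)
qed

text \<open>
  This passage from rank to closure turns the geometry of the configurations into reasoning with
  the axioms of a linear space, \<open>col_merge\<close> below: two points determine their line.
\<close>

lemma col_iff:
  assumes "a \<noteq> b"
  shows "col a b c \<longleftrightarrow> a \<in> ground M \<and> b \<in> ground M \<and> c \<in> cl M {a, b}"
proof
  assume L: "col a b c"
  then have g: "a \<in> ground M" "b \<in> ground M" "c \<in> ground M" by (auto simp: collinear_def)
  moreover have "c \<in> cl M {a, b}"
  proof (rule ccontr)
    assume n: "c \<notin> cl M {a, b}"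
    then have "c \<noteq> a" "c \<noteq> b" using cl_ext[of "{a, b}"] g by auto
    moreover have "indep M {c, a, b}" using indep_insert[OF indep_pair[OF g(1,2) assms] g(3) n] .
    then have "enat (card {c, a, b}) \<le> rank M {a, b, c}" by (intro card_le_rank) auto
    ultimately have "3 \<le> rank M {a, b, c}" using assms by (simp add: numeral_eq_enat eval_nat_numeral)
    moreover have "rank M {a, b, c} \<le> 2" using L by (simp add: collinear_def)
    ultimately have "(3::enat) \<le> 2" by (rule order.trans)
    then show False by simp
  qed
  ultimately show "a \<in> ground M \<and> b \<in> ground M \<and> c \<in> cl M {a, b}" by simp
next
  assume R: "a \<in> ground M \<and> b \<in> ground M \<and> c \<in> cl M {a, b}"
  then have "rank M {a, b, c} \<le> card {a, b}"
    using cl_ext[of "{a, b}"] by (intro rank_le) auto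
  then show "col a b c" using R assms cl_ground[of "{a, b}"]
    by (auto simp: collinear_def two_eq_card_pair[OF assms])
qed

lemma col_ground: "col a b c \<Longrightarrow> a \<in> ground M \<and> b \<in> ground M \<and> c \<in> ground M"
  by (simp add: collinear_def)

lemma col_refl: "a \<in> ground M \<Longrightarrow> b \<in> ground M \<Longrightarrow> col a b b"
proof -
  assume g: "a \<in> ground M" "b \<in> ground M"
  then have "rank M {a, b, b} \<le> card {a, b}"
    using cl_ext[of "{a, b}"] by (intro rank_le) auto
  also have "\<dots> \<le> enat 2" by (simp add: card_insert_if)
  finally show "col a b b" using g by (simp add: collinear_def numeral_eq_enat)
qed

lemma col_degenerate:
  assumes "a \<in> ground M" "b \<in> ground M"
  shows "col a b b" "col a b a" "col a a b"
  using col_refl[of a b] col_refl[of b a] assms by (simp_all add: insert_commute)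

lemma col_merge:
  assumes "a \<noteq> b" "col a b c" "col a b d" "col a b e"
  shows "col c d e"
proof -
  have "{c, d, e} \<subseteq> cl M {a, b}" "{a, b} \<subseteq> ground M" using assms by (auto simp: col_iff)
  then have "rank M {c, d, e} \<le> card {a, b}" "{c, d, e} \<subseteq> ground M"
    using rank_le[of "{a, b}" "{c, d, e}"] cl_ground[of "{a, b}"] by blast+
  then show ?thesis using assms(1) by (simp add: collinear_def two_eq_card_pair)
qed

lemma col_trans: "a \<noteq> b \<Longrightarrow> col a b c \<Longrightarrow> col a b d \<Longrightarrow> col a c d"
  using col_merge[of a b a c d] col_refl[of b a] col_ground[of a b c] by (simp add: insert_commute)

lemma indep_triple_iff:
  assumes "a \<in> ground M" "b \<in> ground M" "c \<in> ground M" "card {a, b, c} = 3"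
  shows "indep M {a, b, c} \<longleftrightarrow> \<not> col a b c"
proof -
  have d: "a \<noteq> b" "c \<noteq> a" "c \<noteq> b" using assms(4) by (auto simp: card_insert_if split: if_splits)
  have "c \<notin> cl M {a, b}" if "indep M {a, b, c}"
  proof -
    have "{a, b, c} - {c} = {a, b}" using d by auto
    then show ?thesis using that by (auto simp: indep_def)
  qed
  moreover have "indep M {a, b, c}" if "c \<notin> cl M {a, b}"
    using indep_insert[OF indep_pair[OF assms(1,2) d(1)] assms(3) that]
    by (simp add: insert_commute)
  ultimately show ?thesis using col_iff[OF d(1)] assms by auto
qed

lemma indep_restr: "S \<subseteq> ground M \<Longrightarrow> indep (restr M S) I \<longleftrightarrow> I \<subseteq> S \<and> indep M I"
  by (auto simp: indep_def restr_def)

lemma rank_restr: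
  assumes "S \<subseteq> ground M" "X \<subseteq> S"
  shows "rank (restr M S) X = rank M X"
proof -
  have "{I. indep (restr M S) I \<and> finite I \<and> I \<subseteq> X} = {I. indep M I \<and> finite I \<and> I \<subseteq> X}"
    using assms by (auto simp: indep_restr)
  then show ?thesis by (simp add: rank_def)
qed

lemma collinear_restr:
  "S \<subseteq> ground M \<Longrightarrow> X \<subseteq> S \<Longrightarrow> collinear (restr M S) X \<longleftrightarrow> collinear M X"
  by (auto simp: collinear_def rank_restr) (auto simp: restr_def)

text \<open>Simplicity is what makes a collinear triple of points have rank exactly two.\<close>

lemma three_point_lines_restr:
  assumes S: "S \<subseteq> ground M"
  shows "three_point_lines (restr M S) =
    {T. T \<subseteq> S \<and> card T = 3 \<and> collinear M T \<and> cl M T \<inter> S = T}"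
proof -
  have "2 \<le> rank M T" if T: "T \<subseteq> S" "card T = 3" for T
  proof -
    obtain a b c where "T = {a, b, c}" "a \<noteq> b" using T(2) by (auto simp: card_3_iff)
    then have "card {a, b} \<le> rank M T"
      using indep_pair[of a b] S T by (intro card_le_rank) auto
    then show ?thesis using \<open>a \<noteq> b\<close> by (simp add: two_eq_card_pair)
  qed
  moreover have "ground (restr M S) = S" "cl (restr M S) T = cl M T \<inter> S" for T
    by (simp_all add: restr_def)
  ultimately show ?thesis using S
    by (auto simp: three_point_lines_def is_line_def rank_restr collinear_def intro: antisym)
qed

section \<open>Harmonic configurations are complete quadrangles\<close>

text \<open>
  The vertices are \<open>a\<close>, \<open>b\<close>, \<open>c\<close>, \<open>d\<close>. Each diagonal point is listed according to the partner of
  \<open>a\<close> on the side through it: \<open>e\<close> is on \<open>ab\<close>, \<open>f\<close> on \<open>ac\<close> and \<open>g\<close> on \<open>ad\<close>. Coplanarity is implied by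
  the existence of the diagonal points.
\<close>

definition quadrangle :: "'a \<Rightarrow> 'a \<Rightarrow> 'a \<Rightarrow> 'a \<Rightarrow> 'a \<Rightarrow> 'a \<Rightarrow> 'a \<Rightarrow> bool" where
  "quadrangle a b c d e f g \<longleftrightarrow>
     \<not> col a b c \<and> \<not> col a b d \<and> \<not> col a c d \<and> \<not> col b c d \<and>
     col a b e \<and> col c d e \<and> col a c f \<and> col b d f \<and> col a d g \<and> col b c g"

text \<open>Together these generate the action of the symmetric group on the vertices.\<close>

lemma quadrangle_swap:
  assumes "quadrangle a b c d e f g"
  shows "quadrangle c d a b e f g" "quadrangle a b d c e g f" "quadrangle a c b d f e g"
  using assms by (auto simp: quadrangle_def insert_commute)

lemma quadrangle_ground:
  "quadrangle a b c d e f g \<Longrightarrow> {a, b, c, d, e, f, g} \<subseteq> ground M"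
  using col_ground by (auto simp: quadrangle_def)

text \<open>
  Up to the symmetries these are all types of triples apart from the sides and the triple of
  diagonal points.
\<close>

lemma quadrangle_noncollinear_at_vertex:
  assumes Q: "quadrangle a b c d e f g"
  shows "\<not> col a b c" "\<not> col a b f" "\<not> col a b g" "\<not> col a e f"
proof -
  note q = Q[unfolded quadrangle_def]
  show "\<not> col a b c" using q by simp
  have f: "a \<noteq> f" using q by (auto simp: insert_commute)
  have g: "a \<noteq> g" using q by (auto simp: insert_commute)
  have e: "a \<noteq> e" using q by (auto simp: insert_commute)
  show 2: "\<not> col a b f" using col_trans[of a f b c] f q by (auto simp: insert_commute)
  show "\<not> col a b g" using col_trans[of a g b d] g q by (auto simp: insert_commute)
  show "\<not> col a e f" using col_trans[of a e b f] e q 2 by (auto simp: insert_commute)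
qed

lemma quadrangle_noncollinear:
  assumes Q: "quadrangle a b c d e f g"
  shows "\<not> col a b c" "\<not> col a b d" "\<not> col a c d" "\<not> col b c d"
    "\<not> col a b f" "\<not> col a b g" "\<not> col c d f" "\<not> col c d g"
    "\<not> col a c e" "\<not> col a c g" "\<not> col b d e" "\<not> col b d g"
    "\<not> col a d e" "\<not> col a d f" "\<not> col b c e" "\<not> col b c f"
    "\<not> col a e f" "\<not> col a e g" "\<not> col a f g"
    "\<not> col b e f" "\<not> col b e g" "\<not> col b f g"
    "\<not> col c e f" "\<not> col c e g" "\<not> col c f g"
    "\<not> col d e f" "\<not> col d e g" "\<not> col d f g"
proof -
  note swap = quadrangle_swap
  \<comment> \<open>Every vertex is brought to the front, and then the other three are permuted cyclically.\<close>
  have cyc: "quadrangle u w x v j k i" if "quadrangle u v w x i j k" for u v w x i j k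
    using swap(2)[OF swap(3)[OF that]] .
  have opp: "quadrangle v u x w i j k" if "quadrangle u v w x i j k" for u v w x i j k
    using swap(2)[OF swap(1)[OF swap(2)[OF swap(1)[OF that]]]] .
  note A = Q and B = opp[OF Q] and C = swap(1)[OF Q] and D = opp[OF swap(1)[OF Q]]
  note N = quadrangle_noncollinear_at_vertex
  note all = N[OF A] N[OF cyc[OF A]] N[OF cyc[OF cyc[OF A]]]
    N[OF B] N[OF cyc[OF B]] N[OF cyc[OF cyc[OF B]]]
    N[OF C] N[OF cyc[OF C]] N[OF cyc[OF cyc[OF C]]]
    N[OF D] N[OF cyc[OF D]] N[OF cyc[OF cyc[OF D]]]
  show "\<not> col a b c" "\<not> col a b d" "\<not> col a c d" "\<not> col b c d"
    "\<not> col a b f" "\<not> col a b g" "\<not> col c d f" "\<not> col c d g"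
    "\<not> col a c e" "\<not> col a c g" "\<not> col b d e" "\<not> col b d g"
    "\<not> col a d e" "\<not> col a d f" "\<not> col b c e" "\<not> col b c f"
    "\<not> col a e f" "\<not> col a e g" "\<not> col a f g"
    "\<not> col b e f" "\<not> col b e g" "\<not> col b f g"
    "\<not> col c e f" "\<not> col c e g" "\<not> col c f g"
    "\<not> col d e f" "\<not> col d e g" "\<not> col d f g"
    using all by (simp_all add: insert_commute)
qed

lemma quadrangle_distinct:
  assumes Q: "quadrangle a b c d e f g"
  shows "distinct [a, b, c, d, e, f, g]"
proof -
  note q = Q[unfolded quadrangle_def] and n = quadrangle_noncollinear[OF Q]
  have refl: "col u v v" "col u u v" if "{u, v} \<subseteq> {a, b, c, d, e, f, g}" for u v
    using col_refl[of u v] col_refl[of v u] quadrangle_ground[OF Q] that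
    by (auto simp: insert_commute)
  show ?thesis using refl[of a b] refl[of a c] refl[of a d] refl[of b c] q n
    by (auto simp: insert_commute)
qed

text \<open>
  A line of the restriction to \<open>S\<close> can be recognised pointwise: no further point of \<open>S\<close> may be
  collinear with two chosen points of the triple.
\<close>

lemma flat_trace_line:
  assumes "u \<noteq> v" "col u v t" "{u, v, t} \<subseteq> S" "S \<subseteq> ground M"
    and "\<And>w. w \<in> S \<Longrightarrow> col u v w \<Longrightarrow> w \<in> {u, v, t}"
  shows "cl M {u, v, t} \<inter> S = {u, v, t}"
proof -
  have g: "{u, v} \<subseteq> ground M" using assms by auto
  have "{u, v, t} \<subseteq> cl M {u, v}" using assms(1,2) g cl_ext[of "{u, v}"] by (simp add: col_iff)
  then have "cl M {u, v, t} \<subseteq> cl M {u, v}" using cl_subset g by blast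
  moreover have "{u, v, t} \<subseteq> cl M {u, v, t}" using assms by (intro cl_ext) auto
  moreover have "w \<in> {u, v, t}" if "w \<in> S" "w \<in> cl M {u, v}" for w
    using assms(5)[OF that(1)] col_iff[OF assms(1), of w] that g by simp
  ultimately show ?thesis using assms(3) by blast
qed

text \<open>
  Of the 35 triples of points, the 28 outside the list are excluded by \<open>quadrangle_noncollinear\<close>.
\<close>

lemma quadrangle_collinear_triple:
  assumes Q: "quadrangle a b c d e f g"
    and uvw: "u \<in> {a, b, c, d, e, f, g}" "v \<in> {a, b, c, d, e, f, g}" "w \<in> {a, b, c, d, e, f, g}"
    and ne: "u \<noteq> v" "u \<noteq> w" "v \<noteq> w" and uvw_col: "col u v w"
  shows "{u, v, w} \<in> {{a, b, e}, {c, d, e}, {a, c, f}, {b, d, f}, {a, d, g}, {b, c, g}, {e, f, g}}"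
proof -
  note n = quadrangle_noncollinear[OF Q, simplified insert_commute]
  show ?thesis
    using uvw ne uvw_col by (elim insertE emptyE; hypsubst; simp add: n insert_commute)
qed

text \<open>
  The definition with rank and collinearity taken in \<open>M\<close> instead of the restriction, and with names
  for the two large sets so that they are unfolded only where needed.
\<close>

lemma HP_alt:
  assumes S: "S = {y, x, z, p, q, r, s}"
    and L: "L = {{y, x, z}, {y, p, q}, {y, r, s}, {x, q, s}, {z, p, s}, {z, q, r}}"
  shows "HP M y x z p q r s \<longleftrightarrow>
    distinct [y, x, z, p, q, r, s] \<and> S \<subseteq> ground M \<and> rank M S = 3 \<and>
    (three_point_lines (restr M S) = L \<or> three_point_lines (restr M S) = insert {x, p, r} L) \<and>
    (\<forall>T. T \<subseteq> S \<and> card T = 3 \<and> collinear M T \<longrightarrow> T \<in> three_point_lines (restr M S))"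
proof -
  have "HP M y x z p q r s \<longleftrightarrow>
    distinct [y, x, z, p, q, r, s] \<and> S \<subseteq> ground M \<and> rank (restr M S) S = 3 \<and>
    (three_point_lines (restr M S) = L \<or> three_point_lines (restr M S) = insert {x, p, r} L) \<and>
    (\<forall>T. T \<subseteq> S \<and> card T = 3 \<and> collinear (restr M S) T \<longrightarrow> T \<in> three_point_lines (restr M S))"
    unfolding HP_def Let_def S L by (rule refl)
  then show ?thesis using rank_restr[of S S] collinear_restr[of S] by auto
qed

lemma HP_imp_quadrangle:
  assumes "HP M y x z p q r s"
  shows "quadrangle y z q s x p r"
proof -
  define S where "S = {y, x, z, p, q, r, s}"
  define L where "L = {{y, x, z}, {y, p, q}, {y, r, s}, {x, q, s}, {z, p, s}, {z, q, r}}"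
  note H = assms[unfolded HP_alt[OF S_def L_def]]
  have d: "distinct [y, x, z, p, q, r, s]" and S: "S \<subseteq> ground M"
    and lines: "three_point_lines (restr M S) = L \<or> three_point_lines (restr M S) = insert {x, p, r} L"
    and T': "\<forall>T. T \<subseteq> S \<and> card T = 3 \<and> collinear M T \<longrightarrow> T \<in> three_point_lines (restr M S)"
    using H[THEN conjunct1] H[THEN conjunct2, THEN conjunct1]
      H[THEN conjunct2, THEN conjunct2, THEN conjunct2, THEN conjunct1]
      H[THEN conjunct2, THEN conjunct2, THEN conjunct2, THEN conjunct2] by this+
  have L: "L \<subseteq> three_point_lines (restr M S)"
      "three_point_lines (restr M S) \<subseteq> insert {x, p, r} L"
    using lines by blast+
  have T: "\<And>T. T \<subseteq> S \<Longrightarrow> card T = 3 \<Longrightarrow> collinear M T \<Longrightarrow> T \<in> three_point_lines (restr M S)"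
    using T' by blast
  have c: "collinear M T" if "T \<in> L" for T
    using subsetD[OF L(1) that] by (simp add: three_point_lines_restr[OF S])
  have n: "\<not> col u v w"
    if "u \<in> S" "v \<in> S" "w \<in> S" "distinct [u, v, w]"
      "\<forall>T \<in> insert {x, p, r} L. u \<notin> T \<or> v \<notin> T \<or> w \<notin> T" for u v w
  proof
    assume "col u v w"
    then have "{u, v, w} \<in> insert {x, p, r} L" using T[of "{u, v, w}"] L(2) that(1-4) by auto
    from bspec[OF that(5) this] show False by simp
  qed
  have "\<not> col y z q" "\<not> col y z s" "\<not> col y q s" "\<not> col z q s"
    using d unfolding atomize_conj
    by (intro conjI; intro n; auto simp: S_def L_def)
  moreover have "col y x z" "col y p q" "col y r s" "col x q s" "col z p s" "col z q r"
    unfolding atomize_conj by (intro conjI; intro c; simp add: L_def)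
  ultimately show ?thesis by (simp add: quadrangle_def insert_commute)
qed

lemma quadrangle_imp_HP:
  assumes Q: "quadrangle a b c d e f g"
  shows "HP M a e b f c g d"
proof -
  define S where "S = {a, e, b, f, c, g, d}"
  define L where "L = {{a, e, b}, {a, f, c}, {a, g, d}, {e, c, d}, {b, f, d}, {b, c, g}}"
  have S_eq: "S = {a, b, c, d, e, f, g}" by (simp add: S_def insert_commute)
  have L_eq: "insert {e, f, g} L =
      {{a, b, e}, {c, d, e}, {a, c, f}, {b, d, f}, {a, d, g}, {b, c, g}, {e, f, g}}"
    by (simp add: L_def insert_commute)
  have S: "S \<subseteq> ground M" using quadrangle_ground[OF Q] S_eq by simp
  have d: "distinct [a, e, b, f, c, g, d]" using quadrangle_distinct[OF Q] by auto
  have triple: "{u, v, w} \<in> insert {e, f, g} L"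
    if "u \<in> S" "v \<in> S" "w \<in> S" "u \<noteq> v" "u \<noteq> w" "v \<noteq> w" "col u v w" for u v w
    using quadrangle_collinear_triple[OF Q, folded S_eq L_eq, OF that] .
  have subset: "T \<in> insert {e, f, g} L" if T: "T \<subseteq> S" "card T = 3" "collinear M T" for T
  proof -
    obtain u v w where "T = {u, v, w}" "u \<noteq> v" "u \<noteq> w" "v \<noteq> w"
      using T(2) by (auto simp: card_3_iff)
    then show ?thesis using triple[of u v w] T(1,3) by blast
  qed
  have line: "{u, v, w} \<in> three_point_lines (restr M S)"
    if "{u, v, w} \<subseteq> S" "distinct [u, v, w]" "col u v w"
      "\<forall>t \<in> S. col u v t \<longrightarrow> t \<in> {u, v, w}" for u v w
    using that flat_trace_line[OF _ that(3,1) S]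
    by (simp add: three_point_lines_restr[OF S])
  have "{a, b, e} \<in> three_point_lines (restr M S)" "{c, d, e} \<in> three_point_lines (restr M S)"
    "{a, c, f} \<in> three_point_lines (restr M S)" "{b, d, f} \<in> three_point_lines (restr M S)"
    "{a, d, g} \<in> three_point_lines (restr M S)" "{b, c, g} \<in> three_point_lines (restr M S)"
    unfolding atomize_conj using Q[unfolded quadrangle_def] d
    by (intro conjI; intro line;
        auto simp: S_eq insert_commute quadrangle_noncollinear[OF Q, simplified insert_commute])
  then have listed_line: "T \<in> three_point_lines (restr M S)" if "T \<in> L" for T
    using that by (auto simp: L_def insert_commute)
  have efg: "{e, f, g} \<in> three_point_lines (restr M S)" if "col e f g"
    using d that by (intro line;
        auto simp: S_eq insert_commute quadrangle_noncollinear[OF Q, simplified insert_commute])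
  have sub: "three_point_lines (restr M S) \<subseteq> insert {e, f, g} L"
    using subset by (auto simp: three_point_lines_restr[OF S])
  moreover have "L \<subseteq> three_point_lines (restr M S)" using listed_line by blast
  ultimately have "three_point_lines (restr M S) = L \<or>
      three_point_lines (restr M S) = insert {e, f, g} L"
    by blast
  moreover have "\<forall>T. T \<subseteq> S \<and> card T = 3 \<and> collinear M T \<longrightarrow> T \<in> three_point_lines (restr M S)"
  proof (intro allI impI)
    fix T assume T: "T \<subseteq> S \<and> card T = 3 \<and> collinear M T"
    then have "T = {e, f, g} \<or> T \<in> L" using subset[of T] by simp
    then show "T \<in> three_point_lines (restr M S)" using efg listed_line T by fastforce
  qed
  moreover have "rank M S = 3"
  proof -
    \<comment> \<open>All points are in the plane of \<open>a\<close>, \<open>b\<close>, \<open>c\<close>; for \<open>d\<close> this holds because \<open>e\<close> is on \<open>cd\<close>.\<close>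
    let ?B = "{a, b, c}"
    have B: "?B \<subseteq> ground M" "card ?B = 3" using S S_def d by auto
    have three: "3 = enat (card ?B)" using B by (simp add: numeral_eq_enat)
    have in_cl: "w \<in> cl M ?B" if "col u v w" "u \<noteq> v" "u \<in> cl M ?B" "v \<in> cl M ?B" for u v w
      using that cl_subset[of "{u, v}" ?B] B(1) by (auto simp: col_iff)
    have b: "a \<in> cl M ?B" "b \<in> cl M ?B" "c \<in> cl M ?B" using cl_ext[OF B(1)] by auto
    note q = Q[unfolded quadrangle_def]
    have e: "e \<in> cl M ?B" using in_cl[of a b e] b d q by simp
    moreover have "f \<in> cl M ?B" using in_cl[of a c f] b d q by simp
    moreover have "g \<in> cl M ?B" using in_cl[of b c g] b d q by simp
    moreover have "d \<in> cl M ?B" using in_cl[of e c d] e b d q by (simp add: insert_commute)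
    ultimately have "rank M S \<le> card ?B" using b B S_def by (intro rank_le) auto
    moreover have "card ?B \<le> rank M S"
      using indep_triple_iff[of a b c] B q S_def by (intro card_le_rank) auto
    ultimately show ?thesis using three by simp
  qed
  ultimately show ?thesis using d S unfolding HP_alt[OF S_def L_def] by (intro conjI)
qed

lemma HP_iff_quadrangle: "HP M y x z p q r s \<longleftrightarrow> quadrangle y z q s x p r"
  using HP_imp_quadrangle quadrangle_imp_HP by blast

end

section \<open>Harmonic conjugates\<close>

locale harmonic_points = simple_points +
  assumes harmonic: "harmonic_matroid M"
begin

lemma fourth_point:
  assumes "quadrangle a b c d e f g"
  obtains e' where "col a b e'" "col f g e'" "harmonic_conj M a b e e'"
proof -
  have H: "HP M a e b f c g d" using assms by (simp add: HP_iff_quadrangle)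
  then obtain e' where e': "cl M {a, b} \<inter> cl M {f, g} = {e'}"
    using harmonic unfolding harmonic_matroid_def by blast
  have "a \<noteq> b" "f \<noteq> g" "{a, b, f, g} \<subseteq> ground M"
    using quadrangle_distinct[OF assms] quadrangle_ground[OF assms] by auto
  then have "col a b e'" "col f g e'" using e' by (auto simp: col_iff)
  moreover have "harmonic_conj M a b e e'" using H e' unfolding harmonic_conj_def by blast
  ultimately show ?thesis using that by blast
qed

lemma harmonic_conj_unique:
  "harmonic_conj M a b e e' \<Longrightarrow> harmonic_conj M a b e e'' \<Longrightarrow> e' = e''"
  using harmonic unfolding harmonic_matroid_def by blast

text \<open>
  Incidence alone suffices to identify the conjugate, as \<open>ab\<close> and \<open>fg\<close> are different lines.
\<close>

lemma harmonic_conjI: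
  assumes Q: "quadrangle a b c d e f g" and "col a b e'" "col f g e'"
  shows "harmonic_conj M a b e e'"
proof -
  obtain t where t: "col a b t" "col f g t" "harmonic_conj M a b e t"
    using fourth_point[OF Q] .
  have "t = e'"
  proof (rule ccontr)
    assume "t \<noteq> e'"
    have ab: "a \<noteq> b" and fg: "f \<noteq> g" using quadrangle_distinct[OF Q] by auto
    have refl: "col a b a" "col a b b" "col f g f"
      using col_refl quadrangle_ground[OF Q] by (auto simp: insert_commute)
    have "col t e' a" "col t e' b" "col t e' f"
      using col_merge[OF ab t(1) assms(2)] col_merge[OF fg t(2) assms(3)] refl by auto
    then have "col a b f" using col_merge[OF \<open>t \<noteq> e'\<close>] by blast
    then show False using quadrangle_noncollinear[OF Q] by simp
  qed
  then show ?thesis using t(3) by simp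
qed

lemma harmonic_conjE:
  assumes "harmonic_conj M a b e e'"
  obtains c d f g where "quadrangle a b c d e f g" "col a b e'" "col f g e'"
proof -
  obtain f c g d where Q: "quadrangle a b c d e f g" and e': "cl M {a, b} \<inter> cl M {f, g} = {e'}"
    using assms unfolding harmonic_conj_def HP_iff_quadrangle by blast
  have "a \<noteq> b" "f \<noteq> g" "{a, b, f, g} \<subseteq> ground M"
    using quadrangle_distinct[OF Q] quadrangle_ground[OF Q] by auto
  then have "col a b e'" "col f g e'" using e' by (auto simp: col_iff)
  then show ?thesis using that Q by blast
qed

text \<open>
  The diagonal points \<open>f\<close>, \<open>g\<close> change places with the vertices \<open>c\<close>, \<open>d\<close>. In the Fano case
  \<open>e' = e\<close> this is one more symmetry of the same seven points.
\<close>

lemma opposite_quadrangle: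
  assumes Q: "quadrangle a b c d e f g" and "col a b e'" "col f g e'"
  shows "quadrangle a b f g e' c d"
  using assms quadrangle_noncollinear[OF Q]
  by (simp add: quadrangle_def insert_commute)

lemma harmonic_conj_swap:
  assumes "harmonic_conj M a b e e'"
  shows "harmonic_conj M a b e' e"
proof -
  obtain c d f g where Q: "quadrangle a b c d e f g" and e': "col a b e'" "col f g e'"
    using harmonic_conjE[OF assms] .
  show ?thesis
    using harmonic_conjI[OF opposite_quadrangle[OF Q e']] Q
    by (simp add: quadrangle_def insert_commute)
qed

text \<open>
  With \<open>ab\<close> at infinity, \<open>k\<close> is the reflection of the centre \<open>P\<close> of the parallelogram \<open>c f d g\<close> in the
  midpoint \<open>v\<close> of its side \<open>cg\<close>, and the claim is that \<open>gk\<close> is parallel to the diagonal \<open>cd\<close>. To see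
  this, mark on the side \<open>cf\<close> the reflection \<open>h\<close> of \<open>f\<close> in \<open>c\<close>. It is the conjugate of \<open>f\<close>
  with respect to \<open>a\<close> and \<open>c\<close> in two ways: cut out by \<open>eg\<close>, and cut out by \<open>dv\<close>. So \<open>eg\<close> and \<open>dv\<close> both pass
  through \<open>h\<close>. Then \<open>v a c d\<close> is a quadrangle with diagonal points \<open>P\<close>, \<open>g\<close>, \<open>h\<close>, and the conjugate
  of \<open>P\<close> that it yields lies on \<open>gh\<close>, which is \<open>eg\<close>.
\<close>

lemma reflected_diagonal_point:
  assumes Q: "quadrangle a b c d e f g"
    and P: "col c d P" "col f g P" and v: "col c g v" "col P a v"
  obtains k where "harmonic_conj M v a P k" "col e g k"
proof -
  note q = Q[unfolded quadrangle_def] and n = quadrangle_noncollinear[OF Q]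
  have E: "{a, b, c, d, e, f, g, P, v} \<subseteq> ground M"
    using quadrangle_ground[OF Q] col_ground[OF P(1)] col_ground[OF v(1)] by simp
  have refl: "col u w w" "col u w u" "col u u w"
    if "u \<in> {a, b, c, d, e, f, g, P, v}" "w \<in> {a, b, c, d, e, f, g, P, v}" for u w
    using col_degenerate[OF subsetD[OF E that(1)] subsetD[OF E that(2)]] .
  have Pc: "P \<noteq> c" using P n by (auto simp: insert_commute)
  have Pd: "P \<noteq> d" using P n by (auto simp: insert_commute)
  have Pg: "P \<noteq> g" using P n by (auto simp: insert_commute)
  have aPg: "\<not> col a P g"
    using col_trans[of g P f a] Pg P n by (auto simp: insert_commute)
  have acP: "\<not> col a c P"
    using col_trans[of c P d a] Pc P n by (auto simp: insert_commute)
  have cPg: "\<not> col c P g"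
    using col_trans[of c P d g] Pc P n by (auto simp: insert_commute)
  have adP: "\<not> col a d P"
    using col_trans[of d P c a] Pd P n by (auto simp: insert_commute)
  have vc: "v \<noteq> c" using v acP by (auto simp: insert_commute)
  have va: "v \<noteq> a" using v n by (auto simp: insert_commute)
  have vac: "\<not> col v a c"
    using col_trans[of c v g a] vc v n by (auto simp: insert_commute)
  have vad: "\<not> col v a d"
    using col_trans[of a v P d] va v adP by (auto simp: insert_commute)
  have vcd: "\<not> col v c d"
    using col_trans[of c v g d] vc v n by (auto simp: insert_commute)
  have Qh: "quadrangle a c b d f e g" using quadrangle_swap(3)[OF Q] .
  obtain h where h: "col a c h" "col e g h" "harmonic_conj M a c f h"
    using fourth_point[OF Qh] .
  \<comment> \<open>A second quadrangle for the conjugate of \<open>f\<close>, so that \<open>h\<close> also lies on \<open>vd\<close>.\<close>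
  have "quadrangle a c P g f v d"
    using q P v aPg acP cPg n by (simp add: quadrangle_def insert_commute)
  then obtain h' where h': "col a c h'" "col v d h'" "harmonic_conj M a c f h'"
    by (rule fourth_point)
  have "h' = h" using harmonic_conj_unique[OF h'(3) h(3)] .
  then have "quadrangle v a c d P g h"
    using q P v h h' vac vad vcd n by (simp add: quadrangle_def insert_commute)
  then obtain k where k: "col v a k" "col g h k" "harmonic_conj M v a P k"
    by (rule fourth_point)
  have "g \<noteq> h" using h(1) n by (auto simp: insert_commute)
  then have "col e g k"
    using col_trans[of g h e k] refl[of e g] h k
      col_merge[of g h e g k] col_refl[of h g] col_ground[OF h(2)] by (auto simp: insert_commute)
  then show ?thesis using that k(3) by blast
qed

text \<open>
  The parallelogram \<open>P c k g\<close> realises the exchanged pairs: its sides pass through \<open>e\<close> and \<open>e'\<close>, its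
  diagonals through \<open>a\<close> and \<open>b\<close>. Here \<open>e \<noteq> e'\<close> keeps \<open>P\<close> off the line \<open>ab\<close>.
\<close>

lemma harmonic_conj_exchange:
  assumes H: "harmonic_conj M a b e e'" and ee': "e \<noteq> e'"
  shows "harmonic_conj M e e' a b"
proof -
  obtain c d f g where Q: "quadrangle a b c d e f g" and e': "col a b e'" "col f g e'"
    using harmonic_conjE[OF H] .
  \<comment> \<open>The mirror image that swaps the two diagonals of the parallelogram and keeps the side \<open>cg\<close>.\<close>
  have Q': "quadrangle a b g f e' d c"
    using quadrangle_swap(2)[OF opposite_quadrangle[OF Q e']] .
  note q = Q[unfolded quadrangle_def] and n = quadrangle_noncollinear[OF Q]
  obtain P where P: "col c d P" "col f g P"
    using fourth_point[OF quadrangle_swap(1)[OF Q]] by blast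
  have "quadrangle c g d f b P a"
    using q P n by (simp add: quadrangle_def insert_commute)
  then obtain v where v: "col c g v" "col P a v" by (rule fourth_point)
  obtain k where k: "harmonic_conj M v a P k" "col e g k"
    using reflected_diagonal_point[OF Q P v] .
  have P': "col g f P" "col d c P" "col g c v" using P v by (simp_all add: insert_commute)
  obtain k' where k': "harmonic_conj M v a P k'" "col e' c k'"
    using reflected_diagonal_point[OF Q' P' v(2)] .
  have "k' = k" using harmonic_conj_unique[OF k'(1) k(1)] .
  with k' have e'ck: "col e' c k" by simp
  have vak: "col v a k" using k(1) by (rule harmonic_conjE)
  have neq: "distinct [a, b, c, d, e, f, g]" using quadrangle_distinct[OF Q] .
  have E: "{a, b, c, d, e, f, g, P, v, k, e'} \<subseteq> ground M"
    using quadrangle_ground[OF Q] col_ground[OF P(1)] col_ground[OF v(1)] col_ground[OF k(2)]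
      col_ground[OF e'(1)] by auto
  have refl: "col u w w" "col u w u" "col u u w"
    if "u \<in> {a, b, c, d, e, f, g, P, v, k, e'}" "w \<in> {a, b, c, d, e, f, g, P, v, k, e'}" for u w
    using col_degenerate[OF subsetD[OF E that(1)] subsetD[OF E that(2)]] .
  have va: "v \<noteq> a" using v n by (auto simp: insert_commute)
  have Pa: "P \<noteq> a" using P n by (auto simp: insert_commute)
  have aPk: "col a P k"
    using col_merge[OF va _ _ vak, of a P] v refl by (auto simp: insert_commute)
  have ee'a: "col e e' a" and ee'b: "col e e' b"
    using col_merge[of a b e e'] neq q e' refl by auto
  \<comment> \<open>A point \<open>P\<close> on \<open>ab\<close> would be both \<open>ab \<inter> cd = e\<close> and \<open>ab \<inter> fg = e'\<close>.\<close>
  have abP: "\<not> col a b P"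
  proof
    assume abP: "col a b P"
    have "P = e"
    proof (rule ccontr)
      assume ne: "P \<noteq> e"
      have "col P e a" using col_merge[of a b P e a] neq abP q refl by auto
      moreover have "col P e c" "col P e d" using col_merge[of c d P e] neq P q refl by auto
      ultimately show False using col_merge[OF ne, of a c d] n by simp
    qed
    moreover have "P = e'"
    proof (rule ccontr)
      assume ne: "P \<noteq> e'"
      have "col P e' a" using col_merge[of a b P e' a] neq abP e' refl by auto
      moreover have "col P e' f" "col P e' g" using col_merge[of f g P e'] neq P e' refl by auto
      ultimately show False using col_merge[OF ne, of a f g] n by simp
    qed
    ultimately show False using ee' by simp
  qed
  have eP: "e \<noteq> P" and e'P: "e' \<noteq> P" using abP q e' by auto
  have ePc: "col e P c" and ePd: "col e P d"
    using col_merge[of c d e P] neq P q refl by auto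
  have e'Pf: "col e' P f" and e'Pg: "col e' P g"
    using col_merge[of f g e' P] neq P e' refl by auto
  \<comment> \<open>General position of \<open>e\<close>, \<open>e'\<close>, \<open>P\<close>, \<open>k\<close>.\<close>
  have "\<not> col e e' P" using col_merge[OF ee' ee'a ee'b] abP by blast
  moreover have "\<not> col e e' k"
  proof
    assume c: "col e e' k"
    have "k = e"
    proof (rule ccontr)
      assume ne: "k \<noteq> e"
      have "col k e a" "col k e b" using col_merge[OF ee' c] ee'a ee'b refl[of e e'] by auto
      moreover have "col k e g" using k(2) by (simp add: insert_commute)
      ultimately show False using col_merge[OF ne, of a b g] n by simp
    qed
    moreover have "k = e'"
    proof (rule ccontr)
      assume ne: "k \<noteq> e'"
      have "col k e' a" "col k e' b" using col_merge[OF ee' c] ee'a ee'b refl[of e e'] by auto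
      moreover have "col k e' c" using e'ck by (simp add: insert_commute)
      ultimately show False using col_merge[OF ne, of a b c] n by simp
    qed
    ultimately show False using ee' by simp
  qed
  moreover have "\<not> col e P k"
  proof
    assume c: "col e P k"
    show False
    proof (cases "P = k")
      case True
      then have "col e P g" using k(2) by (simp add: insert_commute)
      then show False using col_merge[OF eP ePc ePd] n by blast
    next
      case False
      have "col P k c" "col P k d" "col P k a"
        using col_merge[OF eP refl(1) c ePc] col_merge[OF eP refl(1) c ePd] aPk
        by (simp_all add: insert_commute)
      then show False using col_merge[OF False, of a c d] n by blast
    qed
  qed
  moreover have "\<not> col e' P k"
  proof
    assume c: "col e' P k"
    show False
    proof (cases "P = k")
      case True
      then have "col e' P c" using e'ck by (simp add: insert_commute)
      then show False using col_merge[OF e'P _ e'Pf e'Pg] n by blast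
    next
      case False
      have "col P k f" "col P k g" "col P k a"
        using col_merge[OF e'P refl(1) c e'Pf] col_merge[OF e'P refl(1) c e'Pg] aPk
        by (simp_all add: insert_commute)
      then show False using col_merge[OF False, of a f g] n by blast
    qed
  qed
  ultimately have "quadrangle e e' P k a c g"
    using ee'a aPk ePc e'ck k(2) e'Pg by (simp add: quadrangle_def insert_commute)
  then show ?thesis
    using harmonic_conjI ee'b q by (simp add: insert_commute)
qed

end

theorem proposition3p2:
  fixes M :: "'a matroid" and x x' y z :: 'a
  assumes "harmonic_matroid M"
    and "x \<in> ground M" and "x' \<in> ground M" and "y \<in> ground M" and "z \<in> ground M"
  shows "(harmonic_conj M y z x x' \<longleftrightarrow> harmonic_conj M y z x' x) \<and>
         (x \<noteq> x' \<and> y \<noteq> z \<longrightarrow> (harmonic_conj M y z x x' \<longleftrightarrow> harmonic_conj M x x' y z))"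
proof -
  interpret harmonic_points M
    using assms(1) by unfold_locales (simp_all add: harmonic_matroid_def)
  show ?thesis using harmonic_conj_swap harmonic_conj_exchange by blast
qed

end
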